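(* Let $n\geq 4$ be an integer. Then $\Omega_2$ is a type II orbit of minimal driver sets for the cycle graph $C_n$ if and only if $n$ is odd (and $n>3$).
   Context: $C_n$ is the simple undirected cycle graph with vertex set $V=\{1,\ldots,n\}$ and edge set $\{\{1,2\},\{2,3\},\ldots,\{n-1,n\},\{1,n\}\}$, and $d(i,j)$ is the usual graph distance. For $d\in\{1,\ldots,\lfloor n/2\rfloor\}$, $\Omega_d=\{\{i,j\}\subseteq V : i\neq j,\ d(i,j)=d\}$; it is an orbit of 2-subsets of $V$ under the automorphism group of $C_n$. For a simple undirected graph $G=(V,E)$ on $V=\{1,\ldots,n\}$ with (0-1) adjacency matrix $A$ and a non-empty subset $S=\{i_1,\ldots,i_k\}\subseteq V$, $B_S$ denotes the $(n\times k)$-matrix with columns the standard basis vectors $\mathbf{e}_{i_1},\ldots,\mathbf{e}_{i_k}$. A pair $(X,B)$ is controllable if the linear system $\dot{\mathbf{x}}=X\mathbf{x}+B\mathbf{u}$ is controllable. $S$ is a driver set for $G$ if $(A,B_S)$ is controllable; a minimal driver set is a driver set of minimum cardinality (for $C_n$ this minimum is $2$). $\mathrm{Sym}(G)$ is the set of all real symmetric $(n\times n)$-matrices $X=[x_{ij}]$ such that for all $i\neq j$: $x_{ij}\neq 0$ if and only if $\{i,j\}\in E$ (the diagonal entries are free). $\mathrm{Sym}_0(G)$ is the subset of matrices in $\mathrm{Sym}(G)$ all of whose diagonal entries are zero. For a set $F$ of matrices, $(G,S)$ is strongly $F$-controllable if $(X,B_S)$ is controllable for all $X\in F$. A driver set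 $S$ is of type II if $(G,S)$ is strongly $\mathrm{Sym}_0(G)$-controllable but not strongly $\mathrm{Sym}(G)$-controllable. This property is invariant under the automorphism group of $G$; an orbit is a type II orbit of minimal driver sets if its members are minimal driver sets of type II. *)

theory Defs
  imports
    "HOL-Analysis.Analysis"
    "HOL-Combinatorics.Permutations"
    "Jordan_Normal_Form.Matrix"
begin

no_notation vec_nth (infixl "$" 90)

section \<open>Simple graphs on the vertex set {1..n}\<close>

text \<open>
  A graph is given by its order \<open>n\<close>, the vertex set being \<open>{1..n}\<close>, and by its set \<open>E\<close> of edges,
  which are 2-subsets of \<open>{1..n}\<close>.
\<close>

definition simple_graph :: "nat \<Rightarrow> nat set set \<Rightarrow> bool" where
  "simple_graph n E \<longleftrightarrow> (\<forall>e\<in>E. e \<subseteq> {1..n} \<and> card e = 2)"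

text \<open>
  The least number of edges of a walk from \<open>i\<close> to \<open>j\<close>. The value is meaningful only if \<open>i\<close> and \<open>j\<close>
  lie in the same connected component.
\<close>

definition graph_dist :: "nat set set \<Rightarrow> nat \<Rightarrow> nat \<Rightarrow> nat" where
  "graph_dist E i j = (LEAST k. (i, j) \<in> {(u, v). {u, v} \<in> E} ^^ k)"

definition graph_aut :: "nat \<Rightarrow> nat set set \<Rightarrow> (nat \<Rightarrow> nat) set" where
  "graph_aut n E =
     {f. f permutes {1..n} \<and> (\<forall>i\<in>{1..n}. \<forall>j\<in>{1..n}. {f i, f j} \<in> E \<longleftrightarrow> {i, j} \<in> E)}"

definition is_subset_orbit :: "nat \<Rightarrow> nat set set \<Rightarrow> nat set set \<Rightarrow> bool" where
  "is_subset_orbit n E \<Omega> \<longleftrightarrow> (\<exists>S. S \<subseteq> {1..n} \<and> \<Omega> = {f ` S | f. f \<in> graph_aut n E})"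

definition cycle_edges :: "nat \<Rightarrow> nat set set" where
  "cycle_edges n = {{i, Suc i} | i. 1 \<le> i \<and> i < n} \<union> {{1, n}}"

lemma simple_graph_cycle:
  assumes "n \<ge> 3"
  shows "simple_graph n (cycle_edges n)"
  using assms by (auto simp: simple_graph_def cycle_edges_def)

definition Omega :: "nat \<Rightarrow> nat \<Rightarrow> nat set set" where
  "Omega n d =
     {{i, j} | i j. i \<in> {1..n} \<and> j \<in> {1..n} \<and> i \<noteq> j \<and> graph_dist (cycle_edges n) i j = d}"


section \<open>Controllability of linear systems\<close>

text \<open>
  \<open>x\<close> is a trajectory on \<open>[0, T]\<close> of the system \<open>x' = X x + B u\<close> with input \<open>u\<close>. Inputs are the
  Lebesgue integrable functions, and the differential equation is understood in the sense of
  Caratheodory, that is, in integrated form.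
\<close>

definition trajectory ::
  "real mat \<Rightarrow> real mat \<Rightarrow> real \<Rightarrow> (real \<Rightarrow> real Matrix.vec) \<Rightarrow> (real \<Rightarrow> real Matrix.vec) \<Rightarrow> bool" where
  "trajectory X B T u x \<longleftrightarrow>
     (\<forall>t\<in>{0..T}. u t \<in> carrier_vec (dim_col B)) \<and>
     (\<forall>j<dim_col B. (\<lambda>t. u t $ j) absolutely_integrable_on {0..T}) \<and>
     (\<forall>t\<in>{0..T}. x t \<in> carrier_vec (dim_row X)) \<and>
     (\<forall>t\<in>{0..T}. \<forall>i<dim_row X.
        ((\<lambda>s. (X *\<^sub>v x s + B *\<^sub>v u s) $ i) has_integral (x t $ i - x 0 $ i)) {0..t})"

lemma classical_solution_is_trajectory:
  assumes "\<And>t. t \<in> {0..T} \<Longrightarrow> u t \<in> carrier_vec (dim_col B)"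
    and "\<And>j. j < dim_col B \<Longrightarrow> continuous_on {0..T} (\<lambda>t. u t $ j)"
    and "\<And>t. t \<in> {0..T} \<Longrightarrow> x t \<in> carrier_vec (dim_row X)"
    and deriv: "\<And>t i. t \<in> {0..T} \<Longrightarrow> i < dim_row X \<Longrightarrow>
      ((\<lambda>s. x s $ i) has_real_derivative (X *\<^sub>v x t + B *\<^sub>v u t) $ i) (at t within {0..T})"
  shows "trajectory X B T u x"
proof -
  have "((\<lambda>s. (X *\<^sub>v x s + B *\<^sub>v u s) $ i) has_integral (x t $ i - x 0 $ i)) {0..t}"
    if t: "t \<in> {0..T}" and i: "i < dim_row X" for t i
  proof (rule fundamental_theorem_of_calculus)
    show "0 \<le> t" using t by simp
    fix s assume s: "s \<in> {0..t}"
    then have "((\<lambda>s. x s $ i) has_vector_derivative (X *\<^sub>v x s + B *\<^sub>v u s) $ i) (at s within {0..T})"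
      using deriv[of s i] t i by (simp add: has_real_derivative_iff_has_vector_derivative)
    then show "((\<lambda>s. x s $ i) has_vector_derivative (X *\<^sub>v x s + B *\<^sub>v u s) $ i) (at s within {0..t})"
      by (rule has_vector_derivative_within_subset) (use t in auto)
  qed
  then show ?thesis
    using assms by (auto simp: trajectory_def intro: absolutely_integrable_continuous_real)
qed

definition controllable :: "real mat \<Rightarrow> real mat \<Rightarrow> bool" where
  "controllable X B \<longleftrightarrow>
     (\<forall>x0\<in>carrier_vec (dim_row X). \<forall>x1\<in>carrier_vec (dim_row X).
        \<exists>T>0. \<exists>u x. trajectory X B T u x \<and> x 0 = x0 \<and> x T = x1)"


section \<open>Driver sets\<close>

text \<open>
  Matrix indices start at 0: vertex \<open>i\<close> corresponds to row and column \<open>i - 1\<close>.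
\<close>

definition adj_matrix :: "nat \<Rightarrow> nat set set \<Rightarrow> real mat" where
  "adj_matrix n E = Matrix.mat n n (\<lambda>(i, j). if {Suc i, Suc j} \<in> E then 1 else 0)"

definition input_matrix :: "nat \<Rightarrow> nat set \<Rightarrow> real mat" where
  "input_matrix n S = mat_of_cols n (map (\<lambda>i. unit_vec n (i - 1)) (sorted_list_of_set S))"

definition driver_set :: "nat \<Rightarrow> nat set set \<Rightarrow> nat set \<Rightarrow> bool" where
  "driver_set n E S \<longleftrightarrow>
     S \<noteq> {} \<and> S \<subseteq> {1..n} \<and> controllable (adj_matrix n E) (input_matrix n S)"

definition minimal_driver_set :: "nat \<Rightarrow> nat set set \<Rightarrow> nat set \<Rightarrow> bool" where
  "minimal_driver_set n E S \<longleftrightarrow>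
     driver_set n E S \<and> (\<forall>S'. driver_set n E S' \<longrightarrow> card S \<le> card S')"

definition Sym :: "nat \<Rightarrow> nat set set \<Rightarrow> real mat set" where
  "Sym n E =
     {X \<in> carrier_mat n n. transpose_mat X = X \<and>
        (\<forall>i<n. \<forall>j<n. i \<noteq> j \<longrightarrow> (X $$ (i, j) \<noteq> 0 \<longleftrightarrow> {Suc i, Suc j} \<in> E))}"

definition Sym0 :: "nat \<Rightarrow> nat set set \<Rightarrow> real mat set" where
  "Sym0 n E = {X \<in> Sym n E. \<forall>i<n. X $$ (i, i) = 0}"

definition strongly_controllable :: "real mat set \<Rightarrow> nat \<Rightarrow> nat set \<Rightarrow> bool" where
  "strongly_controllable F n S \<longleftrightarrow> (\<forall>X\<in>F. controllable X (input_matrix n S))"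

definition type_II :: "nat \<Rightarrow> nat set set \<Rightarrow> nat set \<Rightarrow> bool" where
  "type_II n E S \<longleftrightarrow>
     driver_set n E S \<and>
     strongly_controllable (Sym0 n E) n S \<and> \<not> strongly_controllable (Sym n E) n S"

definition type_II_orbit :: "nat \<Rightarrow> nat set set \<Rightarrow> nat set set \<Rightarrow> bool" where
  "type_II_orbit n E \<Omega> \<longleftrightarrow>
     is_subset_orbit n E \<Omega> \<and> (\<forall>S\<in>\<Omega>. minimal_driver_set n E S \<and> type_II n E S)"

end

theory Submission
  imports
    Defs
    "HOL-Computational_Algebra.Polynomial"
    "HOL-Number_Theory.Cong"
begin

text \<open>
  Controllability is shown with polynomial trajectories on \<open>[0, 1]\<close>. A polynomial curve \<open>z\<close> with the
  prescribed end points can be chosen such that \<open>z' - X z\<close> vanishes to any given order at both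
  ends; the remaining forcing is absorbed by repeated integration by parts, provided that every unit
  vector lies in the smallest \<open>X\<close>-invariant subspace containing the columns of \<open>B\<close>. Conversely, a left
  eigenvector of \<open>X\<close> that vanishes on the driver set yields a scalar quantity that no input can
  influence.

  For the cycle and \<open>S = {s, s + 2}\<close>, a zero-diagonal \<open>X\<close> links indices at distance 2, and steps of
  length 2 reach every vertex precisely when \<open>n\<close> is odd. For even \<open>n\<close> the indicator of the vertices
  not reached is in the kernel of a suitably signed \<open>X\<close>. With a free diagonal, the vector that is 1
  at \<open>s + 1\<close>, 0 on \<open>S\<close> and \<open>-1\<close> elsewhere can be put in the kernel for every \<open>n \<ge> 4\<close>.
\<close>

section \<open>Steering along polynomials\<close>

hide_const (open) Module.module.smult

text \<open>The polynomial t (1 - t). Divisibility by \<open>flat ^ N\<close> expresses vanishing to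
  order N at both ends of [0, 1].\<close>

definition flat :: "real poly" where "flat = [:0, 1, -1:]"

lemma poly_flat [simp]: "poly flat 0 = 0" "poly flat 1 = 0"
  by (simp_all add: flat_def)

lemma pderiv_flat_sq: "pderiv flat * pderiv flat = 1 - smult 4 flat"
  by (simp add: flat_def pderiv_pCons one_pCons)

text \<open>\<open>R\<close> holds the 0-based rows reached by the input. They carry no equation,
  since the input can supply whatever is missing there.\<close>

definition absorbable :: "nat \<Rightarrow> (nat \<Rightarrow> nat \<Rightarrow> real) \<Rightarrow> nat set \<Rightarrow> (nat \<Rightarrow> real poly) \<Rightarrow> bool" where
  "absorbable n M R f \<longleftrightarrow> (\<exists>w.
     (\<forall>i<n. poly (w i) 0 = 0 \<and> poly (w i) 1 = 0) \<and>
     (\<forall>i<n. i \<notin> R \<longrightarrow> pderiv (w i) = (\<Sum>j<n. smult (M i j) (w j)) + f i))"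

text \<open>The order N may depend on the direction, because every application of \<open>M\<close>
  costs one derivative of \<open>c\<close>.\<close>

definition absorbable_dirs :: "nat \<Rightarrow> (nat \<Rightarrow> nat \<Rightarrow> real) \<Rightarrow> nat set \<Rightarrow> (nat \<Rightarrow> real) set" where
  "absorbable_dirs n M R =
     {v. \<exists>N. \<forall>c. flat ^ N dvd c \<longrightarrow> absorbable n M R (\<lambda>i. smult (v i) c)}"

definition unit_fun :: "nat \<Rightarrow> nat \<Rightarrow> real" where
  "unit_fun k i = (if i = k then 1 else 0)"

section \<open>Absorbable directions as an invariant subspace\<close>

lemma absorbable_add:
  assumes "absorbable n M R f" "absorbable n M R g"
  shows "absorbable n M R (\<lambda>i. f i + g i)"
proof -
  obtain w where w: "\<forall>i<n. poly (w i) 0 = 0 \<and> poly (w i) 1 = 0"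
    "\<forall>i<n. i \<notin> R \<longrightarrow> pderiv (w i) = (\<Sum>j<n. smult (M i j) (w j)) + f i"
    using assms(1) unfolding absorbable_def by blast
  obtain w' where w': "\<forall>i<n. poly (w' i) 0 = 0 \<and> poly (w' i) 1 = 0"
    "\<forall>i<n. i \<notin> R \<longrightarrow> pderiv (w' i) = (\<Sum>j<n. smult (M i j) (w' j)) + g i"
    using assms(2) unfolding absorbable_def by blast
  show ?thesis
    unfolding absorbable_def
    by (rule exI[of _ "\<lambda>i. w i + w' i"])
      (use w w' in \<open>auto simp: pderiv_add smult_add_right sum.distrib\<close>)
qed

lemma absorbable_zero: "absorbable n M R (\<lambda>i. 0)"
  unfolding absorbable_def by (rule exI[of _ "\<lambda>i. 0"]) auto

lemma absorbable_sum:
  assumes "finite K" "\<And>k. k \<in> K \<Longrightarrow> absorbable n M R (f k)"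
  shows "absorbable n M R (\<lambda>i. \<Sum>k\<in>K. f k i)"
  using assms
  by (induction K rule: finite_induct) (auto simp: absorbable_zero intro: absorbable_add)

lemma absorbable_dirs_lincomb:
  assumes "v \<in> absorbable_dirs n M R" "w \<in> absorbable_dirs n M R"
  shows "(\<lambda>i. a * v i + b * w i) \<in> absorbable_dirs n M R"
proof -
  obtain N1 where N1: "\<And>c. flat ^ N1 dvd c \<Longrightarrow> absorbable n M R (\<lambda>i. smult (v i) c)"
    using assms(1) unfolding absorbable_dirs_def by blast
  obtain N2 where N2: "\<And>c. flat ^ N2 dvd c \<Longrightarrow> absorbable n M R (\<lambda>i. smult (w i) c)"
    using assms(2) unfolding absorbable_dirs_def by blast
  have "absorbable n M R (\<lambda>i. smult (a * v i + b * w i) c)" if c: "flat ^ max N1 N2 dvd c" for c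
  proof -
    have "flat ^ N1 dvd smult a c" "flat ^ N2 dvd smult b c"
      using c by (meson dvd_smult dvd_trans le_imp_power_dvd max.cobounded1 max.cobounded2)+
    from absorbable_add[OF N1[OF this(1)] N2[OF this(2)]]
    show ?thesis by (simp add: smult_add_left mult.commute)
  qed
  then show ?thesis unfolding absorbable_dirs_def by blast
qed

lemma pderiv_flat_dvd:
  assumes "flat ^ Suc N dvd c"
  shows "flat ^ N dvd pderiv c"
proof -
  obtain d where d: "c = flat ^ Suc N * d" using assms by (auto simp: dvd_def)
  show ?thesis
    unfolding d pderiv_mult pderiv_power_Suc
    by (intro dvd_add) (auto intro: dvd_mult2 dvd_mult dvd_smult le_imp_power_dvd)
qed

text \<open>Integration by parts: the forcing \<open>c (X v)\<close> is absorbed by \<open>- c v\<close> up to the forcing \<open>c' v\<close>.\<close>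

lemma absorbable_dirs_invariant:
  assumes "v \<in> absorbable_dirs n M R"
  shows "(\<lambda>i. \<Sum>j<n. M i j * v j) \<in> absorbable_dirs n M R"
proof -
  obtain N where N: "\<And>c. flat ^ N dvd c \<Longrightarrow> absorbable n M R (\<lambda>i. smult (v i) c)"
    using assms(1) unfolding absorbable_dirs_def by blast
  have "absorbable n M R (\<lambda>i. smult (\<Sum>j<n. M i j * v j) c)" if c: "flat ^ Suc N dvd c" for c
  proof -
    obtain w where w: "\<forall>i<n. poly (w i) 0 = 0 \<and> poly (w i) 1 = 0"
      "\<forall>i<n. i \<notin> R \<longrightarrow> pderiv (w i) = (\<Sum>j<n. smult (M i j) (w j)) + smult (v i) (pderiv c)"
      using N[OF pderiv_flat_dvd[OF c]] unfolding absorbable_def by blast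
    have "poly c 0 = 0" "poly c 1 = 0"
      using c by (auto simp: dvd_def)
    then show ?thesis
      unfolding absorbable_def
      by (intro exI[of _ "\<lambda>i. w i - smult (v i) c"])
        (use w in \<open>auto simp: pderiv_diff pderiv_smult smult_diff_right sum_subtractf smult_sum\<close>)
  qed
  then show ?thesis unfolding absorbable_dirs_def by blast
qed

lemma unit_fun_in_absorbable_dirs:
  assumes "k \<in> R"
  shows "unit_fun k \<in> absorbable_dirs n M R"
proof -
  have "absorbable n M R (\<lambda>i. smult (unit_fun k i) c)" for c
    unfolding absorbable_def
    by (rule exI[of _ "\<lambda>i. 0"]) (use assms in \<open>auto simp: unit_fun_def\<close>)
  then show ?thesis unfolding absorbable_dirs_def by blast
qed

text \<open>
  Newton iteration along powers of \<open>flat\<close>: since \<open>flat' * flat' = 1 - 4 flat\<close>, the derivative of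
  \<open>flat\<close> is its own inverse modulo \<open>flat\<close>, which gives the correction term.
\<close>

lemma approximate_free_solution:
  "\<exists>z. (\<forall>i<n. poly (z i) 0 = a i \<and> poly (z i) 1 = b i) \<and>
       (\<forall>i<n. flat ^ N dvd pderiv (z i) - (\<Sum>j<n. smult (M i j) (z j)))"
proof (induction N)
  case 0
  show ?case by (rule exI[of _ "\<lambda>i. [:a i, b i - a i:]"]) simp
next
  case (Suc N)
  then obtain z where z: "\<And>i. i < n \<Longrightarrow> poly (z i) 0 = a i \<and> poly (z i) 1 = b i"
    and dvd: "\<And>i. i < n \<Longrightarrow> flat ^ N dvd pderiv (z i) - (\<Sum>j<n. smult (M i j) (z j))" by blast
  have "\<forall>i. \<exists>g. i < n \<longrightarrow> pderiv (z i) - (\<Sum>j<n. smult (M i j) (z j)) = flat ^ N * g"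
    using dvd by (metis dvd_def)
  then obtain g where g: "\<And>i. i < n \<Longrightarrow> pderiv (z i) - (\<Sum>j<n. smult (M i j) (z j)) = flat ^ N * g i"
    by metis
  \<comment> \<open>Differentiating \<open>flat ^ Suc N\<close> yields the factor
    \<open>Suc N * pderiv flat\<close> next to \<open>flat ^ N\<close>; times \<open>h i\<close>
    this is \<open>- g i\<close> modulo \<open>flat\<close>.\<close>
  define h where "h i = smult (- 1 / real (Suc N)) (pderiv flat * g i)" for i
  define z' where "z' i = z i + flat ^ Suc N * h i" for i
  have "flat ^ Suc N dvd pderiv (z' i) - (\<Sum>j<n. smult (M i j) (z' j))" if i: "i < n" for i
  proof -
    have "pderiv (z' i) = pderiv (z i) + flat ^ Suc N * pderiv (h i)
        + smult (real (Suc N)) (flat ^ N * pderiv flat * h i)"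
      unfolding z'_def pderiv_add pderiv_mult pderiv_power_Suc
      by (simp del: power_Suc of_nat_Suc add: algebra_simps)
    also have "smult (real (Suc N)) (flat ^ N * pderiv flat * h i)
        = - (flat ^ N * (pderiv flat * pderiv flat) * g i)"
      unfolding h_def by (simp del: of_nat_Suc add: algebra_simps)
    also have "\<dots> = - (flat ^ N * g i) + flat ^ Suc N * smult 4 (g i)"
      unfolding pderiv_flat_sq by (simp add: algebra_simps)
    finally have "pderiv (z' i) = pderiv (z i) + flat ^ Suc N * pderiv (h i)
        + (- (flat ^ N * g i) + flat ^ Suc N * smult 4 (g i))" .
    moreover have "(\<Sum>j<n. smult (M i j) (z' j))
        = (\<Sum>j<n. smult (M i j) (z j)) + flat ^ Suc N * (\<Sum>j<n. smult (M i j) (h j))"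
      unfolding z'_def by (simp del: power_Suc add: smult_add_right sum.distrib sum_distrib_left)
    ultimately have "pderiv (z' i) - (\<Sum>j<n. smult (M i j) (z' j))
        = flat ^ Suc N * (pderiv (h i) + smult 4 (g i) - (\<Sum>j<n. smult (M i j) (h j)))"
      using g[OF i] by (simp del: power_Suc mult_smult_right add: algebra_simps)
    then show ?thesis by simp
  qed
  moreover have "poly (z' i) 0 = a i \<and> poly (z' i) 1 = b i" if "i < n" for i
    using z[OF that] by (simp add: z'_def)
  ultimately show ?case by blast
qed

text \<open>Take an approximate solution whose defect vanishes to an order sufficient for all unit
  vectors at once, split the defect along them and absorb its negative. The correction vanishes at 0
  and 1, so the end points stay.\<close>

lemma polynomial_steering:
  assumes dirs: "\<And>k. k < n \<Longrightarrow> unit_fun k \<in> absorbable_dirs n M R"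
  shows "\<exists>x. (\<forall>i<n. poly (x i) 0 = a i \<and> poly (x i) 1 = b i) \<and>
     (\<forall>i<n. i \<notin> R \<longrightarrow> pderiv (x i) = (\<Sum>j<n. smult (M i j) (x j)))"
proof -
  have "\<forall>k. \<exists>N. k < n \<longrightarrow>
      (\<forall>c. flat ^ N dvd c \<longrightarrow> absorbable n M R (\<lambda>i. smult (unit_fun k i) c))"
    using dirs unfolding absorbable_dirs_def by blast
  then obtain N where N: "\<And>k c. k < n \<Longrightarrow> flat ^ N k dvd c \<Longrightarrow>
      absorbable n M R (\<lambda>i. smult (unit_fun k i) c)"
    by metis
  obtain K where K: "\<And>k. k < n \<Longrightarrow> N k \<le> K"
    by (metis (full_types) finite_imageI finite_lessThan finite_nat_set_iff_bounded_le imageI lessThan_iff)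
  obtain z where z: "\<And>i. i < n \<Longrightarrow> poly (z i) 0 = a i \<and> poly (z i) 1 = b i"
    and dvd: "\<And>i. i < n \<Longrightarrow> flat ^ K dvd pderiv (z i) - (\<Sum>j<n. smult (M i j) (z j))"
    using approximate_free_solution[of n a b K M] by blast
  define f where "f i = - (pderiv (z i) - (\<Sum>j<n. smult (M i j) (z j)))" for i
  have "absorbable n M R (\<lambda>i. smult (unit_fun k i) (f k))" if "k < n" for k
  proof (rule N[OF that])
    show "flat ^ N k dvd f k"
      unfolding f_def dvd_minus_iff using dvd[OF that] K[OF that] by (meson dvd_trans le_imp_power_dvd)
  qed
  then have "absorbable n M R (\<lambda>i. \<Sum>k<n. smult (unit_fun k i) (f k))"
    by (intro absorbable_sum) auto
  moreover have "(\<Sum>k<n. smult (unit_fun k i) (f k)) = f i" if "i < n" for i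
  proof -
    have "(\<Sum>k<n. smult (unit_fun k i) (f k)) = (\<Sum>k<n. if k = i then f k else 0)"
      by (rule sum.cong) (auto simp: unit_fun_def)
    then show ?thesis using that by simp
  qed
  ultimately obtain w where w: "\<And>i. i < n \<Longrightarrow> poly (w i) 0 = 0 \<and> poly (w i) 1 = 0"
    "\<And>i. i < n \<Longrightarrow> i \<notin> R \<Longrightarrow> pderiv (w i) = (\<Sum>j<n. smult (M i j) (w j)) + f i"
    unfolding absorbable_def by auto
  show ?thesis
    by (rule exI[of _ "\<lambda>i. z i + w i"])
      (use z w in \<open>auto simp: pderiv_add smult_add_right sum.distrib f_def\<close>)
qed

section \<open>Controllability criteria\<close>

lemma input_matrix_carrier:
  assumes "S \<subseteq> {1..n}"
  shows "input_matrix n S \<in> carrier_mat n (card S)"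
  using finite_subset[OF assms] by (simp add: input_matrix_def mat_of_cols_def)

lemma input_matrix_mult_index:
  assumes S: "S \<subseteq> {1..n}" and i: "i < n" and u: "u \<in> carrier_vec (card S)"
  shows "(input_matrix n S *\<^sub>v u) $ i
    = (\<Sum>j<card S. if sorted_list_of_set S ! j = Suc i then u $ j else 0)"
proof -
  have fin: "finite S" using finite_subset[OF S] by simp
  have "(input_matrix n S *\<^sub>v u) $ i = (\<Sum>j<card S. input_matrix n S $$ (i, j) * u $ j)"
    using input_matrix_carrier[OF S] i u
    by (auto simp: scalar_prod_def lessThan_atLeast0 intro!: sum.cong)
  also have "\<dots> = (\<Sum>j<card S. if sorted_list_of_set S ! j = Suc i then u $ j else 0)"
  proof (rule sum.cong)
    fix j assume j: "j \<in> {..<card S}"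
    then have "sorted_list_of_set S ! j \<in> S"
      using fin by (metis lessThan_iff nth_mem set_sorted_list_of_set sorted_list_of_set.length_sorted_key_list_of_set)
    then have "sorted_list_of_set S ! j \<in> {1..n}" using S by blast
    then show "input_matrix n S $$ (i, j) * u $ j
        = (if sorted_list_of_set S ! j = Suc i then u $ j else 0)"
      using i j fin by (auto simp: input_matrix_def mat_of_cols_def unit_vec_def)
  qed simp
  finally show ?thesis .
qed

lemma input_matrix_mult_index_eq_0:
  assumes S: "S \<subseteq> {1..n}" and i: "i < n" and u: "u \<in> carrier_vec (card S)"
    and notin: "Suc i \<notin> S"
  shows "(input_matrix n S *\<^sub>v u) $ i = 0"
proof -
  have fin: "finite S" using finite_subset[OF S] by simp
  have "sorted_list_of_set S ! j \<noteq> Suc i" if "j < card S" for j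
    using notin that fin
    by (metis nth_mem set_sorted_list_of_set sorted_list_of_set.length_sorted_key_list_of_set)
  then show ?thesis
    unfolding input_matrix_mult_index[OF S i u] by (intro sum.neutral) auto
qed

text \<open>Makes any forcing \<open>g\<close> on the driver rows available as an input. Subtracting
  1 turns a vertex into a matrix index.\<close>

lemma input_matrix_mult_index_driver:
  assumes S: "S \<subseteq> {1..n}" and i: "i < n" and driver: "Suc i \<in> S"
  shows "(input_matrix n S *\<^sub>v Matrix.vec (card S) (\<lambda>j. g (sorted_list_of_set S ! j - 1))) $ i = g i"
proof -
  have fin: "finite S" using finite_subset[OF S] by simp
  let ?xs = "sorted_list_of_set S"
  obtain k where k: "k < card S" "?xs ! k = Suc i"
    using driver fin
    by (metis in_set_conv_nth set_sorted_list_of_set sorted_list_of_set.length_sorted_key_list_of_set)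
  have eq: "?xs ! j = Suc i \<longleftrightarrow> j = k" if "j < card S" for j
    using k that fin nth_eq_iff_index_eq[of ?xs j k] by auto
  have "(input_matrix n S *\<^sub>v Matrix.vec (card S) (\<lambda>j. g (?xs ! j - 1))) $ i
      = (\<Sum>j<card S. if ?xs ! j = Suc i then Matrix.vec (card S) (\<lambda>j. g (?xs ! j - 1)) $ j else 0)"
    by (rule input_matrix_mult_index[OF S i]) simp
  also have "\<dots> = (\<Sum>j<card S. if j = k then g i else 0)"
  proof (rule sum.cong)
    fix j assume "j \<in> {..<card S}"
    moreover have "?xs ! k - 1 = i" using k by simp
    ultimately show "(if ?xs ! j = Suc i then Matrix.vec (card S) (\<lambda>j. g (?xs ! j - 1)) $ j else 0)
        = (if j = k then g i else 0)"
      using eq[of j] by auto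
  qed simp
  also have "\<dots> = g i" using k by simp
  finally show ?thesis .
qed

lemma controllableI:
  assumes X: "X \<in> carrier_mat n n" and S: "S \<subseteq> {1..n}"
    and dirs: "\<And>k. k < n \<Longrightarrow>
      unit_fun k \<in> absorbable_dirs n (\<lambda>i j. X $$ (i, j)) {i. Suc i \<in> S}"
  shows "controllable X (input_matrix n S)"
  unfolding controllable_def
proof (intro ballI)
  fix x0 x1 :: "real Matrix.vec"
  assume x01: "x0 \<in> carrier_vec (dim_row X)" "x1 \<in> carrier_vec (dim_row X)"
  have B: "input_matrix n S \<in> carrier_mat n (card S)" by (rule input_matrix_carrier[OF S])
  obtain p where bd: "\<And>i. i < n \<Longrightarrow> poly (p i) 0 = x0 $ i \<and> poly (p i) 1 = x1 $ i"
    and ode: "\<And>i. i < n \<Longrightarrow> Suc i \<notin> S \<Longrightarrow>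
      pderiv (p i) = (\<Sum>j<n. smult (X $$ (i, j)) (p j))"
    using polynomial_steering[OF dirs, of "\<lambda>i. x0 $ i" "\<lambda>i. x1 $ i"] by auto
  \<comment> \<open>The defect of the curve, which is 0 off the driver rows, serves as the
    input.\<close>
  define g where "g i = pderiv (p i) - (\<Sum>j<n. smult (X $$ (i, j)) (p j))" for i
  define x where "x t = Matrix.vec n (\<lambda>i. poly (p i) t)" for t
  define u where "u t = Matrix.vec (card S) (\<lambda>j. poly (g (sorted_list_of_set S ! j - 1)) t)" for t
  have Bu: "(input_matrix n S *\<^sub>v u t) $ i = poly (g i) t" if i: "i < n" for t i
  proof (cases "Suc i \<in> S")
    case True
    show ?thesis unfolding u_def
      by (rule input_matrix_mult_index_driver[OF S i True, of "\<lambda>i. poly (g i) t"])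
  next
    case False
    then have "g i = 0" using ode[OF i] by (simp add: g_def)
    then show ?thesis using input_matrix_mult_index_eq_0[OF S i _ False] by (simp add: u_def)
  qed
  have Xx: "(X *\<^sub>v x t) $ i = (\<Sum>j<n. X $$ (i, j) * poly (p j) t)" if i: "i < n" for t i
    using X i by (auto simp: x_def scalar_prod_def lessThan_atLeast0 intro!: sum.cong)
  have "trajectory X (input_matrix n S) 1 u x"
  proof (rule classical_solution_is_trajectory)
    fix t i assume "i < dim_row X"
    then have i: "i < n" using X by simp
    have "(X *\<^sub>v x t + input_matrix n S *\<^sub>v u t) $ i = poly (pderiv (p i)) t"
      using B i by (simp add: Bu Xx g_def poly_sum del: index_mult_mat_vec)
    then show "((\<lambda>s. x s $ i) has_real_derivative (X *\<^sub>v x t + input_matrix n S *\<^sub>v u t) $ i)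
        (at t within {0..1})"
      using i poly_DERIV[of "p i" t] by (simp add: x_def has_field_derivative_at_within)
  next
    fix j assume "j < dim_col (input_matrix n S)"
    then show "continuous_on {0..1} (\<lambda>t. u t $ j)"
      using B by (auto simp: u_def intro!: continuous_intros)
  qed (use X B in \<open>auto simp: u_def x_def\<close>)
  moreover have "x 0 = x0" "x 1 = x1"
    using bd x01 X by (auto simp: x_def)
  ultimately show "\<exists>T>0. \<exists>u x. trajectory X (input_matrix n S) T u x \<and> x 0 = x0 \<and> x T = x1"
    by (intro exI[of _ 1]) auto
qed

text \<open>As an indefinite integral \<open>y\<close> is continuous, hence differentiable with
  derivative \<open>l * y\<close>, so \<open>exp (- l * t) * y t\<close> is constant.\<close>

lemma linear_integral_equation_zero:
  fixes y :: "real \<Rightarrow> real"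
  assumes T: "T > 0" and y0: "y 0 = 0"
    and int: "\<And>t. t \<in> {0..T} \<Longrightarrow> ((\<lambda>s. l * y s) has_integral y t - y 0) {0..t}"
  shows "y T = 0"
proof -
  have ion: "(\<lambda>s. l * y s) integrable_on {0..T}" using int[of T] T by auto
  have y_eq: "y t = integral {0..t} (\<lambda>s. l * y s)" if "t \<in> {0..T}" for t
    using integral_unique[OF int[OF that]] y0 by linarith
  have cont: "continuous_on {0..T} y"
    using indefinite_integral_continuous_1[OF ion] by (subst continuous_on_cong[OF refl y_eq]) auto
  have deriv: "(y has_real_derivative l * y t) (at t within {0..T})" if t: "t \<in> {0..T}" for t
  proof -
    have "((\<lambda>t. integral {0..t} (\<lambda>s. l * y s)) has_real_derivative l * y t) (at t within {0..T})"
      by (rule integral_has_real_derivative[OF _ t]) (intro continuous_intros cont)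
    then show ?thesis
      by (rule has_field_derivative_transform_within[where d = 1]) (use t y_eq in auto)
  qed
  have "((\<lambda>t. exp (- l * t) * y t) has_real_derivative 0) (at t within {0..T})" if t: "t \<in> {0..T}" for t
    by (rule derivative_eq_intros deriv[OF t] refl)+ (simp add: algebra_simps)
  then obtain c where "\<And>t. t \<in> {0..T} \<Longrightarrow> exp (- l * t) * y t = c"
    using has_field_derivative_zero_constant[of "{0..T}" "\<lambda>t. exp (- l * t) * y t"] by auto
  from this[of 0] this[of T] show ?thesis using y0 T by simp
qed

text \<open>The necessity half of the Hautus test for a real eigenvalue: the pairing of
  \<open>v\<close> with the state obeys y' = l y whatever the input, so from state 0 the state
  \<open>unit_vec n k\<close> is out of reach.\<close>

lemma not_controllableI:
  assumes X: "X \<in> carrier_mat n n" and S: "S \<subseteq> {1..n}"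
    and eig: "\<And>j. j < n \<Longrightarrow> (\<Sum>i<n. v i * X $$ (i, j)) = l * v j"
    and van: "\<And>i. Suc i \<in> S \<Longrightarrow> v i = 0"
    and k: "k < n" "v k \<noteq> 0"
  shows "\<not> controllable X (input_matrix n S)"
proof
  assume "controllable X (input_matrix n S)"
  then obtain T u x where T: "T > 0" and tr: "trajectory X (input_matrix n S) T u x"
    and x0: "x 0 = 0\<^sub>v n" and xT: "x T = unit_vec n k"
    unfolding controllable_def using X by (metis carrier_matD(1) unit_vec_carrier zero_carrier_vec)
  have B: "input_matrix n S \<in> carrier_mat n (card S)" by (rule input_matrix_carrier[OF S])
  define y where "y t = (\<Sum>i<n. v i * x t $ i)" for t
  have "y T = 0"
  proof (rule linear_integral_equation_zero[OF T])
    show "y 0 = 0" by (simp add: y_def x0)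
    fix t assume t: "t \<in> {0..T}"
    let ?F = "\<lambda>s. X *\<^sub>v x s + input_matrix n S *\<^sub>v u s"
    have "((\<lambda>s. \<Sum>i<n. v i * ?F s $ i) has_integral (\<Sum>i<n. v i * (x t $ i - x 0 $ i))) {0..t}"
      using tr t X unfolding trajectory_def
      by (intro has_integral_sum has_integral_mult_right) auto
    moreover have "(\<Sum>i<n. v i * (x t $ i - x 0 $ i)) = y t - y 0"
      by (simp add: y_def right_diff_distrib sum_subtractf)
    moreover have "(\<Sum>i<n. v i * ?F s $ i) = l * y s" if s: "s \<in> {0..t}" for s
    proof -
      have sT: "s \<in> {0..T}" using s t by auto
      have xs: "x s \<in> carrier_vec n" and us: "u s \<in> carrier_vec (card S)"
        using tr sT X B unfolding trajectory_def by auto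
      have "v i * ?F s $ i = (\<Sum>j<n. v i * X $$ (i, j) * x s $ j)" if i: "i < n" for i
      proof -
        have "(X *\<^sub>v x s) $ i = (\<Sum>j<n. X $$ (i, j) * x s $ j)"
          using X i xs by (auto simp: scalar_prod_def lessThan_atLeast0 intro!: sum.cong)
        moreover have "v i * (input_matrix n S *\<^sub>v u s) $ i = 0"
          using input_matrix_mult_index_eq_0[OF S i us] van by auto
        ultimately show ?thesis
          using B i by (simp add: distrib_left sum_distrib_left mult.assoc)
      qed
      then have "(\<Sum>i<n. v i * ?F s $ i) = (\<Sum>i<n. \<Sum>j<n. v i * X $$ (i, j) * x s $ j)"
        by (intro sum.cong) auto
      also have "\<dots> = (\<Sum>j<n. \<Sum>i<n. v i * X $$ (i, j) * x s $ j)"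
        by (rule sum.swap)
      also have "\<dots> = (\<Sum>j<n. l * v j * x s $ j)"
        by (intro sum.cong refl) (simp add: eig flip: sum_distrib_right)
      finally show ?thesis by (simp add: y_def sum_distrib_left mult.assoc)
    qed
    ultimately show "((\<lambda>s. l * y s) has_integral y t - y 0) {0..t}"
      by (metis (no_types, lifting) has_integral_eq)
  qed
  moreover have "y T = (\<Sum>i<n. if i = k then v i else 0)"
    unfolding y_def xT by (intro sum.cong) (auto simp: unit_vec_def k)
  ultimately show False using k by simp
qed

section \<open>Cycles\<close>

lemma cycle_edges_iff:
  assumes "n \<ge> 3" "i < n" "j < n"
  shows "{Suc i, Suc j} \<in> cycle_edges n \<longleftrightarrow> j = Suc i mod n \<or> i = Suc j mod n"
proof -
  have *: "Suc a mod n = (if a = n - 1 then 0 else Suc a)" if "a < n" for a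
    using that by (cases "a = n - 1") auto
  show ?thesis
    unfolding *[OF assms(2)] *[OF assms(3)] using assms
    by (auto simp: cycle_edges_def doubleton_eq_iff)
qed

lemma mod_add_inj:
  fixes k l m n :: nat
  assumes "k < n" "l < n"
  shows "(m + k) mod n = (m + l) mod n \<longleftrightarrow> k = l"
  using assms cong_add_lcancel_nat[of m k l n] by (simp add: cong_def)

text \<open>Writing an index as \<open>Suc m mod n\<close> gives it the neighbours \<open>m\<close>
  and \<open>m + 2\<close> modulo n, with no truncated subtraction.\<close>

lemma cycle_neighbours_iff:
  assumes n: "n \<ge> 3" and j: "j < n"
  shows "{Suc (Suc m mod n), Suc j} \<in> cycle_edges n \<longleftrightarrow> j = m mod n \<or> j = (m + 2) mod n"
proof -
  have "Suc m mod n = Suc j mod n \<longleftrightarrow> j = m mod n"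
    using j cong_add_lcancel_nat[of 1 m j n] by (auto simp: cong_def)
  moreover have "Suc (Suc m mod n) mod n = (m + 2) mod n"
    by (simp add: mod_Suc_eq)
  ultimately show ?thesis
    using cycle_edges_iff[OF n _ j, of "Suc m mod n"] n by auto
qed

lemma cycle_row_sum:
  fixes c :: "nat \<Rightarrow> real"
  assumes n: "n \<ge> 3"
  shows "(\<Sum>j<n. if {Suc (Suc m mod n), Suc j} \<in> cycle_edges n then c j else 0)
    = c (m mod n) + c ((m + 2) mod n)"
proof -
  have ne: "m mod n \<noteq> (m + 2) mod n" using mod_add_inj[of 0 n 2 m] n by simp
  have "(\<Sum>j<n. if {Suc (Suc m mod n), Suc j} \<in> cycle_edges n then c j else 0)
      = (\<Sum>j<n. (if j = m mod n then c j else 0) + (if j = (m + 2) mod n then c j else 0))"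
    by (rule sum.cong) (use ne cycle_neighbours_iff[OF n] in auto)
  also have "\<dots> = c (m mod n) + c ((m + 2) mod n)"
    using n by (simp add: sum.distrib)
  finally show ?thesis .
qed

lemma cycle_index_cases:
  fixes i n s :: nat
  assumes "n > 0" "i < n" obtains k where "k < n" "i = (s + k) mod n"
proof -
  \<comment> \<open>The witness is the offset i - s modulo n; adding n first keeps the subtraction
    from truncating.\<close>
  have "(s + (i + n - s mod n) mod n) mod n = i"
  proof -
    have "s mod n < n" using assms by simp
    have "(s + (i + n - s mod n) mod n) mod n = (s mod n + (i + n - s mod n)) mod n"
      by (metis mod_add_left_eq mod_add_right_eq)
    also have "\<dots> = (i + n) mod n" using \<open>s mod n < n\<close> by simp
    finally show ?thesis using assms by simp
  qed
  then show ?thesis using that assms by (metis mod_less_divisor)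
qed

text \<open>Only the residue of \<open>s\<close> matters, so \<open>range (chord n)\<close> collects
  the pairs at all positions of the cycle.\<close>

definition chord :: "nat \<Rightarrow> nat \<Rightarrow> nat set" where
  "chord n s = {Suc (s mod n), Suc ((s + 2) mod n)}"

lemma chord_subset: "n > 0 \<Longrightarrow> chord n s \<subseteq> {1..n}"
  by (auto simp: chord_def Suc_le_eq)

lemma card_chord: "n \<ge> 3 \<Longrightarrow> card (chord n s) = 2"
  using mod_add_inj[of 0 n 2 s] by (simp add: chord_def)

section \<open>Zero-diagonal matrices on odd cycles\<close>

lemma absorbable_dirs_cong:
  assumes "v \<in> absorbable_dirs n M R" "\<And>i. i < n \<Longrightarrow> v i = w i"
  shows "w \<in> absorbable_dirs n M R"
  using assms unfolding absorbable_dirs_def absorbable_def by simp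

lemma cycle_edges_irrefl: "n \<ge> 2 \<Longrightarrow> {i, i} \<notin> cycle_edges n"
  by (auto simp: cycle_edges_def doubleton_eq_iff)

text \<open>The zero diagonal leaves only the two neighbours in a column. As \<open>b\<close> is
  nonzero, the unit vector at \<open>m + 2\<close> can be recovered from the column and the unit
  vector at \<open>m\<close>.\<close>

lemma Sym0_column:
  assumes n: "n \<ge> 3" and X: "X \<in> Sym0 n (cycle_edges n)"
  shows "\<exists>a b. b \<noteq> 0 \<and> (\<forall>i<n. X $$ (i, Suc m mod n)
    = a * unit_fun (m mod n) i + b * unit_fun ((m + 2) mod n) i)"
proof (intro exI conjI allI impI)
  let ?c = "Suc m mod n"
  have X_eq_0_iff: "X $$ (i, ?c) = 0 \<longleftrightarrow> i \<noteq> m mod n \<and> i \<noteq> (m + 2) mod n" if i: "i < n" for i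
  proof -
    have "X $$ (i, ?c) = 0 \<longleftrightarrow> {Suc ?c, Suc i} \<notin> cycle_edges n"
    proof (cases "i = ?c")
      case True
      then show ?thesis using X i cycle_edges_irrefl[of n "Suc i"] n by (simp add: Sym0_def)
    next
      case False
      moreover have "?c < n" using n by simp
      ultimately have "X $$ (i, ?c) \<noteq> 0 \<longleftrightarrow> {Suc i, Suc ?c} \<in> cycle_edges n"
        using X i unfolding Sym0_def Sym_def by blast
      then show ?thesis by (simp only: insert_commute) blast
    qed
    then show ?thesis using cycle_neighbours_iff[OF n i] by simp
  qed
  show "X $$ ((m + 2) mod n, ?c) \<noteq> 0"
    using X_eq_0_iff[of "(m + 2) mod n"] n by simp
  have "m mod n \<noteq> (m + 2) mod n" using mod_add_inj[of 0 n 2 m] n by simp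
  then show "X $$ (i, ?c) = X $$ (m mod n, ?c) * unit_fun (m mod n) i
      + X $$ ((m + 2) mod n, ?c) * unit_fun ((m + 2) mod n) i" if "i < n" for i
    using X_eq_0_iff[OF that] by (auto simp: unit_fun_def)
qed

text \<open>
  Let \<open>V\<close> be an \<open>X\<close>-invariant subspace containing \<open>e s\<close> and \<open>e (s + 2)\<close>. As \<open>X (e (s + 1))\<close> lies in
  \<open>V\<close>, the space \<open>V + span {e (s + 1)}\<close> is invariant as well; containing three consecutive unit
  vectors, it is everything, so \<open>V\<close> contains the image of \<open>X\<close>. Hence \<open>e m \<in> V\<close> implies
  \<open>e (m + 2) \<in> V\<close>, and steps of length 2 exhaust an odd cycle.
\<close>

lemma Sym0_controllable:
  assumes n: "n \<ge> 3" and "odd n" and X: "X \<in> Sym0 n (cycle_edges n)"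
  shows "controllable X (input_matrix n (chord n s))"
proof -
  define V where "V = absorbable_dirs n (\<lambda>i j. X $$ (i, j)) {i. Suc i \<in> chord n s}"
  define e where "e k = unit_fun ((s + k) mod n)" for k
  note lin = absorbable_dirs_lincomb[of _ n "\<lambda>i j. X $$ (i, j)" "{i. Suc i \<in> chord n s}", folded V_def]
  have e0: "e 0 \<in> V" and e2: "e 2 \<in> V"
    unfolding e_def V_def
    by (auto intro!: unit_fun_in_absorbable_dirs simp: chord_def)
  obtain a b where b: "\<And>k. b k \<noteq> 0"
    and col: "\<And>k i. i < n \<Longrightarrow> X $$ (i, (s + Suc k) mod n) = a k * e k i + b k * e (k + 2) i"
  proof -
    have "\<forall>k. \<exists>a b. b \<noteq> 0 \<and> (\<forall>i<n. X $$ (i, (s + Suc k) mod n) = a * e k i + b * e (k + 2) i)"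
      using Sym0_column[OF n X, of "s + k" for k] by (simp add: e_def add.assoc)
    then show thesis using that by metis
  qed
  have Xe: "(\<Sum>j<n. X $$ (i, j) * e (Suc k) j) = a k * e k i + b k * e (k + 2) i" if "i < n" for i k
  proof -
    have "(\<Sum>j<n. X $$ (i, j) * e (Suc k) j)
        = (\<Sum>j<n. if j = (s + Suc k) mod n then X $$ (i, j) else 0)"
      by (rule sum.cong) (auto simp: e_def unit_fun_def)
    then show ?thesis using col[OF that] n by simp
  qed
  \<comment> \<open>X (e 1) lies in the span of \<open>e 0\<close> and \<open>e 2\<close>, hence in
    \<open>V\<close>, so its multiple by \<open>c\<close> can be removed from the image.\<close>
  have image: "(\<lambda>i. a k * e k i + b k * e (k + 2) i) \<in> V"
    if "(\<lambda>i. e (Suc k) i + c * e 1 i) \<in> V" for k c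
  proof -
    have "(\<lambda>i. \<Sum>j<n. X $$ (i, j) * (e (Suc k) j + c * e (Suc 0) j)) \<in> V"
      using that absorbable_dirs_invariant unfolding V_def One_nat_def by blast
    then have "(\<lambda>i. (a k * e k i + b k * e (k + 2) i) + c * (a 0 * e 0 i + b 0 * e 2 i)) \<in> V"
      unfolding V_def
    proof (rule absorbable_dirs_cong)
      fix i assume i: "i < n"
      have "(\<Sum>j<n. X $$ (i, j) * (e (Suc k) j + c * e (Suc 0) j))
        = (\<Sum>j<n. X $$ (i, j) * e (Suc k) j) + c * (\<Sum>j<n. X $$ (i, j) * e (Suc 0) j)"
        by (simp add: distrib_left sum.distrib sum_distrib_left mult.left_commute)
      then show "(\<Sum>j<n. X $$ (i, j) * (e (Suc k) j + c * e (Suc 0) j))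
        = (a k * e k i + b k * e (k + 2) i) + c * (a 0 * e 0 i + b 0 * e 2 i)"
        by (simp add: Xe[OF i] numeral_2_eq_2)
    qed
    from lin[OF this lin[OF e0 e2, of "a 0" "b 0"], of 1 "- c"] show ?thesis
      by simp
  qed
  \<comment> \<open>Membership in V + span {e 1} is expressed through the coefficient
    \<open>c\<close>. Two consecutive indices are carried along because \<open>e (k + 2)\<close> is
    obtained from \<open>e k\<close> and \<open>e (k + 1)\<close>.\<close>
  have near: "(\<exists>c. (\<lambda>i. e k i + c * e 1 i) \<in> V) \<and> (\<exists>c. (\<lambda>i. e (Suc k) i + c * e 1 i) \<in> V)" for k
  proof (induction k)
    case 0
    have "(\<lambda>i. e 0 i + 0 * e 1 i) \<in> V" using e0 by simp
    \<comment> \<open>With coefficient -1 the vector is zero.\<close>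
    moreover have "(\<lambda>i. e (Suc 0) i + (-1) * e 1 i) \<in> V" using lin[OF e0 e0, of 0 0] by simp
    ultimately show ?case by blast
  next
    case (Suc k)
    then obtain c d where c: "(\<lambda>i. e k i + c * e 1 i) \<in> V"
      and d: "(\<lambda>i. e (Suc k) i + d * e 1 i) \<in> V" by blast
    have "(\<lambda>i. (1 / b k) * (a k * e k i + b k * e (k + 2) i)
        + (- a k / b k) * (e k i + c * e 1 i)) \<in> V"
      by (rule lin[OF image[OF d] c])
    moreover have "(\<lambda>i. (1 / b k) * (a k * e k i + b k * e (k + 2) i)
        + (- a k / b k) * (e k i + c * e 1 i)) = (\<lambda>i. e (Suc (Suc k)) i + (- a k * c / b k) * e 1 i)"
      using b[of k] by (auto simp: field_simps)
    ultimately have "(\<lambda>i. e (Suc (Suc k)) i + (- a k * c / b k) * e 1 i) \<in> V" by simp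
    then show ?case using d by blast
  qed
  have step: "e (k + 2) \<in> V" if ek: "e k \<in> V" for k
  proof -
    obtain c where c: "(\<lambda>i. e (Suc k) i + c * e 1 i) \<in> V" using near by blast
    have "(\<lambda>i. (1 / b k) * (a k * e k i + b k * e (k + 2) i) + (- a k / b k) * e k i) \<in> V"
      by (rule lin[OF image[OF c] ek])
    moreover have "(\<lambda>i. (1 / b k) * (a k * e k i + b k * e (k + 2) i) + (- a k / b k) * e k i)
        = e (k + 2)"
      using b[of k] by (auto simp: field_simps)
    ultimately show ?thesis by simp
  qed
  have even_step: "e (2 * k) \<in> V" for k
    by (induction k) (use e0 step in auto)
  have e_in: "e k \<in> V" for k
  proof (cases "even k")
    case True
    then show ?thesis using even_step by (metis dvd_def)
  next
    case False
    \<comment> \<open>Going once round the cycle fixes the vertex and, n being odd, changes the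
      parity of the offset.\<close>
    then have "even (k + n)" using \<open>odd n\<close> by simp
    then have "e (k + n) \<in> V" using even_step by (metis dvd_def)
    then show ?thesis by (simp add: e_def flip: add.assoc)
  qed
  show ?thesis
  proof (rule controllableI)
    show "X \<in> carrier_mat n n" using X by (simp add: Sym0_def Sym_def)
    show "chord n s \<subseteq> {1..n}" using chord_subset n by simp
    fix i assume "i < n"
    then obtain k where "i = (s + k) mod n" using cycle_index_cases[of n i s] n by auto
    then show "unit_fun i \<in> absorbable_dirs n (\<lambda>i j. X $$ (i, j)) {i. Suc i \<in> chord n s}"
      using e_in[of k] by (simp add: e_def V_def)
  qed
qed

section \<open>Eigenvectors vanishing on driver sets\<close>

lemma cycle_predecessor:
  assumes "j < n" obtains m where "j = Suc m mod n"
  using assms that[of "j + n - 1"] by simp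

text \<open>Where the kernel vector is nonzero, the free diagonal entry cancels the sum over the
  neighbours. At s and s + 2 that sum vanishes by itself: s + 1 contributes 1 and the other
  neighbour -1, being none of s, s + 1, s + 2 as n >= 4.\<close>

lemma not_strongly_Sym_controllable:
  assumes n: "n \<ge> 4"
  shows "\<not> strongly_controllable (Sym n (cycle_edges n)) n (chord n s)"
proof -
  have n3: "n \<ge> 3" using n by simp
  define p where "p k = (s + k) mod n" for k
  have p_eq_iff: "p k = p l \<longleftrightarrow> k = l" if "k < n" "l < n" for k l
    unfolding p_def by (rule mod_add_inj[OF that])
  define v :: "nat \<Rightarrow> real" where
    "v i = (if i = p 1 then 1 else if i = p 0 \<or> i = p 2 then 0 else - 1)" for i
  define w where "w i = (\<Sum>j<n. if {Suc i, Suc j} \<in> cycle_edges n then v j else 0)" for i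
  \<comment> \<open>On the driver set \<open>v i = 0\<close>, and division by zero makes the
    diagonal entry 0.\<close>
  define X where "X = Matrix.mat n n (\<lambda>(i, j).
    if i = j then - w i / v i else if {Suc i, Suc j} \<in> cycle_edges n then 1 else 0)"
  have "X \<in> Sym n (cycle_edges n)"
    by (auto simp: Sym_def X_def insert_commute)
  moreover have "\<not> controllable X (input_matrix n (chord n s))"
  proof (rule not_controllableI[where v = v and l = 0 and k = "p 1"])
    show "X \<in> carrier_mat n n" by (simp add: X_def)
    show "chord n s \<subseteq> {1..n}" using chord_subset n by simp
    show "p 1 < n" "v (p 1) \<noteq> 0" using n by (simp_all add: p_def v_def)
    show "v i = 0" if "Suc i \<in> chord n s" for i
    proof -
      have "i = p 0 \<or> i = p 2" using that by (auto simp: chord_def p_def)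
      then show ?thesis using p_eq_iff n by (auto simp: v_def)
    qed
    fix j assume j: "j < n"
    have "(\<Sum>i<n. v i * X $$ (i, j)) = (\<Sum>i<n. (if i = j then v j * (- w j / v j) else 0)
        + (if {Suc j, Suc i} \<in> cycle_edges n then v i else 0))"
      using j cycle_edges_irrefl[of n] n by (intro sum.cong) (auto simp: X_def insert_commute)
    also have "\<dots> = v j * (- w j / v j) + w j"
      using j by (simp add: sum.distrib w_def)
    also have "\<dots> = 0"
    proof (cases "v j = 0")
      case True
      then consider "j = p 0" | "j = p 2" by (auto simp: v_def split: if_splits)
      then have "w j = 0"
      proof cases
        case 1
        then have "j = Suc (s + n - 1) mod n" using n by (simp add: p_def)
        then have "w j = v ((s + n - 1) mod n) + v ((s + n - 1 + 2) mod n)"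
          by (simp only: w_def cycle_row_sum[OF n3])
        moreover have "(s + n - 1) mod n = p (n - 1)" using n by (simp add: p_def)
        moreover have "(s + n - 1 + 2) mod n = p 1"
        proof -
          have "s + n - 1 + 2 = s + 1 + n" using n by simp
          then show ?thesis unfolding p_def by (simp only: mod_add_self2)
        qed
        moreover have "v (p (n - 1)) = - 1" "v (p 1) = 1"
          using n p_eq_iff[of "n - 1"] by (auto simp: v_def)
        ultimately show ?thesis by (simp only:)
      next
        case 2
        then have "j = Suc (s + 1) mod n" by (simp add: p_def)
        then have "w j = v ((s + 1) mod n) + v ((s + 1 + 2) mod n)"
          by (simp only: w_def cycle_row_sum[OF n3])
        then have "w j = v (p 1) + v (p 3)" by (simp add: p_def numeral_3_eq_3)
        then show ?thesis using n by (simp add: v_def p_eq_iff)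
      qed
      then show ?thesis by simp
    qed simp
    finally show "(\<Sum>i<n. v i * X $$ (i, j)) = 0 * v j" by simp
  qed
  ultimately show ?thesis by (auto simp: strongly_controllable_def)
qed

text \<open>The edges {i, i + 1} with i even (0-based) form a perfect matching; they get weight -1,
  the others 1. An even index then sees two odd neighbours with opposite weights, and an odd index
  has only even neighbours, where \<open>v\<close> is 0.\<close>

lemma even_not_strongly_Sym0_controllable:
  assumes n: "n \<ge> 4" and "even n"
  shows "\<not> strongly_controllable (Sym0 n (cycle_edges n)) n (chord n 0)"
proof -
  have n3: "n \<ge> 3" using n by simp
  define v :: "nat \<Rightarrow> real" where "v i = (if odd i then 1 else 0)" for i
  define \<sigma> :: "nat \<Rightarrow> nat \<Rightarrow> real" where
    "\<sigma> i j = (if even i \<and> j = Suc i \<or> even j \<and> i = Suc j then - 1 else 1)" for i j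
  define X where "X = Matrix.mat n n (\<lambda>(i, j).
    if {Suc i, Suc j} \<in> cycle_edges n then \<sigma> i j else 0)"
  have "\<sigma> i j = \<sigma> j i" "\<sigma> i j \<noteq> 0" for i j
    by (auto simp: \<sigma>_def)
  then have "X \<in> Sym0 n (cycle_edges n)"
    using cycle_edges_irrefl[of n] n by (auto simp: Sym0_def Sym_def X_def insert_commute)
  moreover have "\<not> controllable X (input_matrix n (chord n 0))"
  proof (rule not_controllableI[where v = v and l = 0 and k = 1])
    show "X \<in> carrier_mat n n" by (simp add: X_def)
    show "chord n 0 \<subseteq> {1..n}" using chord_subset n by simp
    show "1 < n" "v 1 \<noteq> 0" using n by (simp_all add: v_def)
    show "v i = 0" if "Suc i \<in> chord n 0" for i
      using that n by (auto simp: chord_def v_def)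
    fix j assume j: "j < n"
    define m where "m = j + n - 1"
    have jm: "j = Suc m mod n" using j by (simp add: m_def)
    have "(\<Sum>i<n. v i * X $$ (i, j))
        = (\<Sum>i<n. if {Suc j, Suc i} \<in> cycle_edges n then v i * \<sigma> i j else 0)"
      using j by (intro sum.cong) (auto simp: X_def insert_commute)
    also have "\<dots> = v (m mod n) * \<sigma> (m mod n) j + v ((m + 2) mod n) * \<sigma> ((m + 2) mod n) j"
      unfolding jm by (rule cycle_row_sum[OF n3])
    also have "\<dots> = 0"
    proof (cases "odd j")
      case True
      then have "even m" using \<open>even n\<close> n by (simp add: m_def)
      then show ?thesis using \<open>even n\<close> by (simp add: v_def dvd_mod_iff)
    next
      case False
      then have "odd m" using \<open>even n\<close> n by (simp add: m_def)
      \<comment> \<open>The last index n - 1 is odd, so the successor of an even \<open>j\<close>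
        does not wrap around.\<close>
      have "Suc j < n" using j False \<open>even n\<close> by (metis Suc_lessI even_Suc)
      moreover have "m + 2 = Suc j + n" using n by (simp add: m_def)
      ultimately have succ: "(m + 2) mod n = Suc j" by (simp only: mod_add_self2 mod_less)
      have "m mod n \<noteq> (m + 2) mod n" using mod_add_inj[of 0 n 2 m] n by simp
      then show ?thesis
        using \<open>odd m\<close> False \<open>even n\<close> unfolding succ by (auto simp: v_def \<sigma>_def dvd_mod_iff)
    qed
    finally show "(\<Sum>i<n. v i * X $$ (i, j)) = 0 * v j" by simp
  qed
  ultimately show ?thesis by (auto simp: strongly_controllable_def)
qed

lemma sin_mod_period:
  assumes "n > 0"
  shows "sin (2 * pi * (real (k mod n) - c) / real n) = sin (2 * pi * (real k - c) / real n)"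
proof -
  have "real k = real (k mod n) + real n * real (k div n)"
    by (metis mod_mult_div_eq of_nat_add of_nat_mult)
  then have "2 * pi * (real k - c) / real n
      = 2 * pi * (real (k mod n) - c) / real n + 2 * real (k div n) * pi"
    using assms by (simp add: field_simps)
  then show ?thesis by (simp only: sin_add sin_2npi cos_2npi)
qed

text \<open>The eigenvector \<open>sin (2 \<pi> (j - i) / n)\<close> of the cycle vanishes at \<open>i\<close>.\<close>

lemma cycle_not_driver_singleton:
  assumes n: "n \<ge> 3" and i: "i < n"
  shows "\<not> controllable (adj_matrix n (cycle_edges n)) (input_matrix n {Suc i})"
proof -
  define F where "F k = sin (2 * pi * (real k - real i) / real n)" for k :: nat
  have F_mod: "F (k mod n) = F k" for k
    unfolding F_def by (rule sin_mod_period) (use n in simp)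
  show ?thesis
  proof (rule not_controllableI[where v = F and l = "2 * cos (2 * pi / real n)"])
    show "adj_matrix n (cycle_edges n) \<in> carrier_mat n n" by (simp add: adj_matrix_def)
    show "{Suc i} \<subseteq> {1..n}" using i by simp
    show "Suc i mod n < n" using n by simp
    have "sin (2 * pi / real n) > 0"
      using n by (intro sin_gt_zero) (auto simp: field_simps)
    then show "F (Suc i mod n) \<noteq> 0" unfolding F_mod by (simp add: F_def)
    show "F k = 0" if "Suc k \<in> {Suc i}" for k using that by (simp add: F_def)
    fix j assume j: "j < n"
    then obtain m where m: "j = Suc m mod n" by (rule cycle_predecessor)
    have "(\<Sum>i<n. F i * adj_matrix n (cycle_edges n) $$ (i, j))
        = (\<Sum>i<n. if {Suc j, Suc i} \<in> cycle_edges n then F i else 0)"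
      using j by (intro sum.cong) (auto simp: adj_matrix_def insert_commute)
    also have "\<dots> = F m + F (m + 2)"
      unfolding m cycle_row_sum[OF n] F_mod ..
    also have "\<dots> = 2 * cos (2 * pi / real n) * F (Suc m)"
    proof -
      \<comment> \<open>The identity behind the eigenvalue is sin (t - h) + sin (t + h) = 2 cos h
        sin t.\<close>
      let ?t = "2 * pi * (real (Suc m) - real i) / real n" and ?h = "2 * pi / real n"
      have "2 * pi * (real m - real i) / real n = ?t - ?h"
        "2 * pi * (real (m + 2) - real i) / real n = ?t + ?h"
        using n by (simp_all add: field_simps)
      then show ?thesis unfolding F_def by (simp only: sin_add sin_diff) simp
    qed
    finally show "(\<Sum>i<n. F i * adj_matrix n (cycle_edges n) $$ (i, j))
        = 2 * cos (2 * pi / real n) * F j"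
      unfolding m F_mod .
  qed
qed

section \<open>Pairs at distance 2 as an orbit\<close>

lemma cycle_path_edges:
  assumes "n \<ge> 3"
  shows "{Suc (m mod n), Suc (Suc m mod n)} \<in> cycle_edges n"
  using cycle_edges_iff[OF assms, of "m mod n" "Suc m mod n"] assms by (simp add: mod_Suc_eq)

lemma cycle_edge_vertices:
  assumes "n \<ge> 3" "{i, j} \<in> cycle_edges n"
  shows "i \<in> {1..n}" "j \<in> {1..n}"
  using simple_graph_cycle[OF assms(1)] assms(2) by (auto simp: simple_graph_def)

text \<open>A middle index m + 1 has only the neighbours m and m + 2. This recognises chords both
  among pairs at distance 2 and among images under automorphisms.\<close>

lemma common_neighbour_imp_chord:
  assumes n: "n \<ge> 3" and "{i, k} \<in> cycle_edges n" "{k, j} \<in> cycle_edges n" "i \<noteq> j"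
  shows "{i, j} \<in> range (chord n)"
proof -
  have "i \<in> {1..n}" "k \<in> {1..n}" "j \<in> {1..n}"
    using cycle_edge_vertices[OF n] assms by blast+
  then obtain i' j' k' where ijk: "i = Suc i'" "j = Suc j'" "k = Suc k'" "i' < n" "j' < n" "k' < n"
    by (cases i; cases j; cases k) auto
  obtain m where m: "k' = Suc m mod n" using ijk(6) by (rule cycle_predecessor)
  have "i' = m mod n \<or> i' = (m + 2) mod n" "j' = m mod n \<or> j' = (m + 2) mod n"
    using cycle_neighbours_iff[OF n, of i' m] cycle_neighbours_iff[OF n, of j' m] assms ijk m
    by (auto simp: insert_commute)
  then have "{i, j} = chord n m" using \<open>i \<noteq> j\<close> ijk by (auto simp: chord_def)
  then show ?thesis by simp
qed

text \<open>Ensures that the \<open>LEAST\<close> in \<open>graph_dist\<close> is attained, so that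
  distance 2 yields an actual walk of length 2.\<close>

lemma cycle_connected:
  assumes n: "n \<ge> 3" and "i \<in> {1..n}" "j \<in> {1..n}"
  shows "(i, j) \<in> {(u, v). {u, v} \<in> cycle_edges n}\<^sup>*"
proof -
  let ?R = "{(u, v). {u, v} \<in> cycle_edges n}"
  have from_1: "(1, Suc k) \<in> ?R\<^sup>*" if "k < n" for k
    using that
  proof (induction k)
    case (Suc k)
    then have "(Suc k, Suc (Suc k)) \<in> ?R"
      using cycle_path_edges[OF n, of k] by simp
    then show ?case using Suc by (simp add: rtrancl_into_rtrancl)
  qed simp
  have "sym ?R" by (auto simp: sym_def insert_commute)
  then have "sym (?R\<^sup>*)" by (rule sym_rtrancl)
  have "(1, i) \<in> ?R\<^sup>*" "(1, j) \<in> ?R\<^sup>*"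
    using from_1[of "i - 1"] from_1[of "j - 1"] assms by auto
  then show ?thesis using \<open>sym (?R\<^sup>*)\<close> by (meson rtrancl_trans symD)
qed

text \<open>Distance 2 gives a common neighbour. Conversely, the ends of a chord are joined through
  s + 1 and, for n >= 4, are neither equal nor adjacent.\<close>

lemma Omega_2_eq:
  assumes n: "n \<ge> 4"
  shows "Omega n 2 = range (chord n)"
proof -
  have n3: "n \<ge> 3" using n by simp
  let ?R = "{(u, v). {u, v} \<in> cycle_edges n}"
  have "{i, j} \<in> range (chord n)"
    if ij: "i \<in> {1..n}" "j \<in> {1..n}" "i \<noteq> j" "graph_dist (cycle_edges n) i j = 2" for i j
  proof -
    obtain k where "(i, j) \<in> ?R ^^ k"
      using cycle_connected[OF n3 ij(1,2)] by (auto simp: rtrancl_power)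
    then have "(i, j) \<in> ?R ^^ 2"
      using ij(4) unfolding graph_dist_def by (metis (mono_tags, lifting) LeastI)
    then obtain m where "{i, m} \<in> cycle_edges n" "{m, j} \<in> cycle_edges n"
      by (auto simp: numeral_2_eq_2 relcomp_unfold)
    then show ?thesis using common_neighbour_imp_chord[OF n3] ij(3) by blast
  qed
  moreover have "chord n s \<in> Omega n 2" for s
  proof -
    define i j where "i = s mod n" and "j = (s + 2) mod n"
    have ne: "i \<noteq> j" using mod_add_inj[of 0 n 2 s] n by (simp add: i_def j_def)
    have "j \<noteq> Suc i mod n" using mod_add_inj[of 2 n 1 s] n by (simp add: i_def j_def mod_Suc_eq)
    \<comment> \<open>Adjacency the other way round would make 3 divisible by n.\<close>
    moreover have "i \<noteq> Suc j mod n"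
    proof -
      have "Suc j mod n = (s + 3) mod n" by (simp add: j_def mod_Suc_eq numeral_3_eq_3)
      then show ?thesis using mod_add_inj[of 0 n 3 s] n by (simp add: i_def)
    qed
    ultimately have nonadj: "{Suc i, Suc j} \<notin> cycle_edges n"
      using cycle_edges_iff[OF n3, of i j] n by (simp add: i_def j_def)
    have "(LEAST k. (Suc i, Suc j) \<in> ?R ^^ k) = 2"
    proof (rule Least_equality)
      have "{Suc i, Suc (Suc s mod n)} \<in> cycle_edges n" "{Suc (Suc s mod n), Suc j} \<in> cycle_edges n"
        using cycle_path_edges[OF n3, of s] cycle_path_edges[OF n3, of "Suc s"]
        by (simp_all add: i_def j_def)
      then show "(Suc i, Suc j) \<in> ?R ^^ 2"
        by (auto simp: numeral_2_eq_2 relcomp_unfold)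
      fix k assume k: "(Suc i, Suc j) \<in> ?R ^^ k"
      have "k \<noteq> 0" using k ne by (auto intro: ccontr)
      moreover have "k \<noteq> 1" using k nonadj by auto
      ultimately show "2 \<le> k" by simp
    qed
    moreover have "Suc i \<in> {1..n}" "Suc j \<in> {1..n}" using n by (simp_all add: i_def j_def Suc_le_eq)
    moreover have "chord n s = {Suc i, Suc j}" by (simp add: chord_def i_def j_def)
    ultimately show ?thesis
      using ne unfolding Omega_def graph_dist_def by blast
  qed
  ultimately show ?thesis unfolding Omega_def by blast
qed

text \<open>The identity outside \<open>{1..n}\<close>, as \<open>permutes\<close> demands.\<close>

definition rotation :: "nat \<Rightarrow> nat \<Rightarrow> nat \<Rightarrow> nat" where
  "rotation n s i = (if i \<in> {1..n} then Suc ((s + (i - 1)) mod n) else i)"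

lemma rotation_in_graph_aut:
  assumes n: "n \<ge> 3"
  shows "rotation n s \<in> graph_aut n (cycle_edges n)"
proof -
  have inj: "inj_on (rotation n s) {1..n}"
  proof (rule inj_onI)
    fix i j assume ij: "i \<in> {1..n}" "j \<in> {1..n}" "rotation n s i = rotation n s j"
    then have "i - 1 = j - 1" using mod_add_inj[of "i - 1" n "j - 1" s] by (auto simp: rotation_def)
    then show "i = j" using ij by auto
  qed
  have "rotation n s ` {1..n} \<subseteq> {1..n}"
    using n by (auto simp: rotation_def Suc_le_eq)
  then have "bij_betw (rotation n s) {1..n} {1..n}"
    using inj endo_inj_surj[of "{1..n}" "rotation n s"] by (simp add: bij_betw_def)
  then have "rotation n s permutes {1..n}"
    by (rule bij_imp_permutes) (auto simp: rotation_def)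
  moreover have "{rotation n s i, rotation n s j} \<in> cycle_edges n \<longleftrightarrow> {i, j} \<in> cycle_edges n"
    if ij: "i \<in> {1..n}" "j \<in> {1..n}" for i j
  proof -
    obtain a b where ab: "i = Suc a" "j = Suc b" "a < n" "b < n"
      using ij by (cases i; cases j) auto
    have shift: "(s + y) mod n = Suc ((s + x) mod n) mod n \<longleftrightarrow> y = Suc x mod n" if "y < n" for x y
    proof -
      have "Suc ((s + x) mod n) mod n = (s + Suc x mod n) mod n"
        by (simp add: mod_Suc_eq mod_add_right_eq)
      then show ?thesis using mod_add_inj[OF that, of "Suc x mod n" s] n by simp
    qed
    show ?thesis
      using ab n cycle_edges_iff[OF n, of "(s + a) mod n" "(s + b) mod n"] cycle_edges_iff[OF n, of a b]
      by (simp add: rotation_def shift)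
  qed
  ultimately show ?thesis by (simp add: graph_aut_def)
qed

text \<open>Rotations carry the chord at 0 to every chord. Conversely, an automorphism maps the path
  0, 1, 2 to a path with distinct ends, which form a chord; this avoids describing the whole
  automorphism group.\<close>

lemma chords_orbit:
  assumes n: "n \<ge> 3"
  shows "range (chord n) = {f ` chord n 0 | f. f \<in> graph_aut n (cycle_edges n)}"
proof (intro equalityI subsetI)
  fix C assume "C \<in> range (chord n)"
  then obtain s where "C = chord n s" by blast
  moreover have "rotation n s ` chord n 0 = chord n s"
    using n by (auto simp: chord_def rotation_def)
  ultimately show "C \<in> {f ` chord n 0 | f. f \<in> graph_aut n (cycle_edges n)}"
    using rotation_in_graph_aut[OF n, of s] by blast
next
  fix C assume "C \<in> {f ` chord n 0 | f. f \<in> graph_aut n (cycle_edges n)}"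
  then obtain f where C: "C = f ` chord n 0" and f: "f \<in> graph_aut n (cycle_edges n)" by blast
  define u where "u k = Suc (k mod n)" for k
  have u_in: "u k \<in> {1..n}" for k using n by (simp add: u_def Suc_le_eq)
  have edges: "{u 0, u 1} \<in> cycle_edges n" "{u 1, u 2} \<in> cycle_edges n"
    using cycle_path_edges[OF n, of 0] cycle_path_edges[OF n, of 1] by (simp_all add: u_def numeral_2_eq_2)
  have "u 0 \<noteq> u 2" using n by (simp add: u_def)
  moreover have "inj f"
    using f by (auto simp: graph_aut_def intro: permutes_inj)
  ultimately have "f (u 0) \<noteq> f (u 2)" by (auto dest: injD)
  moreover have "{f (u 0), f (u 1)} \<in> cycle_edges n" "{f (u 1), f (u 2)} \<in> cycle_edges n"
    using f edges u_in by (auto simp: graph_aut_def)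
  ultimately have "{f (u 0), f (u 2)} \<in> range (chord n)"
    using common_neighbour_imp_chord[OF n] by blast
  then show "C \<in> range (chord n)" by (simp add: C chord_def u_def numeral_2_eq_2)
qed

section \<open>Minimal driver sets and the equivalence\<close>

lemma adj_matrix_in_Sym0:
  assumes "n \<ge> 2"
  shows "adj_matrix n (cycle_edges n) \<in> Sym0 n (cycle_edges n)"
  using cycle_edges_irrefl[OF assms] by (auto simp: Sym0_def Sym_def adj_matrix_def insert_commute)

lemma cycle_driver_set_card:
  assumes n: "n \<ge> 3" and S: "driver_set n (cycle_edges n) S"
  shows "card S \<ge> 2"
proof -
  have ne: "S \<noteq> {}" and sub: "S \<subseteq> {1..n}"
    and ctrl: "controllable (adj_matrix n (cycle_edges n)) (input_matrix n S)"
    using S by (simp_all add: driver_set_def)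
  have "finite S" using finite_subset[OF sub] by simp
  then have "card S \<noteq> 0" using ne by simp
  moreover have "card S \<noteq> 1"
  proof
    assume "card S = 1"
    then obtain a where "S = {a}" by (auto simp: card_1_singleton_iff)
    moreover from this sub obtain i where "a = Suc i" "i < n" by (cases a) auto
    ultimately show False using cycle_not_driver_singleton[OF n] ctrl by simp
  qed
  ultimately show ?thesis by simp
qed

theorem theorem22:
  fixes n :: nat
  assumes "n \<ge> 4"
  shows "type_II_orbit n (cycle_edges n) (Omega n 2) \<longleftrightarrow> odd n \<and> n > 3"
proof -
  have n3: "n \<ge> 3" using assms by simp
  show ?thesis
  proof
    assume "type_II_orbit n (cycle_edges n) (Omega n 2)"
    \<comment> \<open>One member of the orbit suffices: for even n the chord at 0 violates type
      II.\<close>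
    then have "type_II n (cycle_edges n) (chord n 0)"
      by (simp add: type_II_orbit_def Omega_2_eq[OF assms])
    then show "odd n \<and> n > 3"
      using even_not_strongly_Sym0_controllable[OF assms] assms by (auto simp: type_II_def)
  next
    assume "odd n \<and> n > 3"
    then have "odd n" by simp
    have Sym0: "strongly_controllable (Sym0 n (cycle_edges n)) n (chord n s)" for s
      using Sym0_controllable[OF n3 \<open>odd n\<close>] by (simp add: strongly_controllable_def)
    \<comment> \<open>The adjacency matrix itself lies in \<open>Sym0\<close>, so strong
      controllability makes every chord a driver set.\<close>
    have driver: "driver_set n (cycle_edges n) (chord n s)" for s
      using Sym0 adj_matrix_in_Sym0[of n] chord_subset[of n s] n3
      by (auto simp: driver_set_def strongly_controllable_def chord_def)
    have "minimal_driver_set n (cycle_edges n) (chord n s)" for s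
      using driver cycle_driver_set_card[OF n3] card_chord[OF n3] by (simp add: minimal_driver_set_def)
    moreover have "type_II n (cycle_edges n) (chord n s)" for s
      using driver Sym0 not_strongly_Sym_controllable[OF assms] by (simp add: type_II_def)
    moreover have "is_subset_orbit n (cycle_edges n) (range (chord n))"
      using chords_orbit[OF n3] chord_subset[of n 0] n3 unfolding is_subset_orbit_def by auto
    ultimately show "type_II_orbit n (cycle_edges n) (Omega n 2)"
      unfolding type_II_orbit_def Omega_2_eq[OF assms] by blast
  qed
qed

end
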